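(* Let $A_1,\ldots,A_k$ be real symmetric $n\times n$ matrices and assume the subspace $\mathcal{V}$ of $M_n(\mathbb{R})$ they span contains a nonsingular matrix. There exist diagonal matrices $\Lambda_i$ and a nonsingular $R\in M_n(\mathbb{R})$ with $A_i=R\Lambda_iR^T$ for all $i=1,\ldots,k$ if and only if both of the following hold: (a) there exists a nonsingular $A\in\mathcal{V}$ such that $A^{-1}\mathcal{V}$ is a commuting subspace (equivalently, $A^{-1}\mathcal{V}$ is a commuting subspace for every nonsingular $A\in\mathcal{V}$); (b) there exists an invertible $B\in\mathcal{V}$ such that the matrices $B^{-1}A_i$ ($i=1,\ldots,k$) are all diagonalizable with real eigenvalues.
   Context: $A^{-1}\mathcal{V}=\{A^{-1}M: M\in\mathcal{V}\}$. A subspace of matrices is commuting if any two of its elements commute. *)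

theory Defs
  imports "HOL-Analysis.Analysis"
begin

definition diagonal_matrix :: "'a::zero^'n^'n \<Rightarrow> bool" where
  "diagonal_matrix D \<longleftrightarrow> (\<forall>i j. i \<noteq> j \<longrightarrow> D $ i $ j = 0)"

definition symmetric_matrix :: "'a^'n^'n \<Rightarrow> bool" where
  "symmetric_matrix M \<longleftrightarrow> transpose M = M"

definition commuting_subspace :: "(real^'n^'n) set \<Rightarrow> bool" where
  "commuting_subspace W \<longleftrightarrow> subspace W \<and> (\<forall>X\<in>W. \<forall>Y\<in>W. X ** Y = Y ** X)"

definition diagonalizable_matrix :: "'a::field^'n^'n \<Rightarrow> bool" where
  "diagonalizable_matrix M \<longleftrightarrow>
     (\<exists>P D :: 'a^'n^'n. invertible P \<and> diagonal_matrix D \<and> M = P ** D ** matrix_inv P)"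

definition eigenvalue :: "'a::field^'n^'n \<Rightarrow> 'a \<Rightarrow> bool" where
  "eigenvalue M c \<longleftrightarrow> (\<exists>v. v \<noteq> 0 \<and> M *v v = c *s v)"

text \<open>
  The eigenvalues of a real matrix are taken in the complex numbers, so that asking for them to be
  real is a genuine condition, and diagonalizability is likewise understood over the complex
  numbers. Together the two conditions amount to diagonalizability over the reals.
\<close>
definition diagonalizable_real_eigenvalues :: "real^'n^'n \<Rightarrow> bool" where
  "diagonalizable_real_eigenvalues M \<longleftrightarrow>
     diagonalizable_matrix (map_matrix complex_of_real M) \<and>
     (\<forall>c. eigenvalue (map_matrix complex_of_real M) c \<longrightarrow> c \<in> \<real>)"

end

theory Submission
  imports Defs
begin

text \<open>
  A decomposition \<open>A\<^sub>i = R \<Lambda>\<^sub>i R\<^sup>T\<close> gives \<open>M\<^sup>-\<^sup>1 V\<close> a common diagonal form in the basis of columns of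
  \<open>(R\<^sup>T)\<^sup>-\<^sup>1\<close>. Conversely, \<open>X M\<^sup>-\<^sup>1 Y = Y M\<^sup>-\<^sup>1 X\<close> on \<open>V\<close> holds for one nonsingular \<open>M\<close> iff it holds
  for all, so the \<open>B\<^sup>-\<^sup>1 A\<^sub>i\<close> commute and their common eigenvectors span. Each \<open>B\<^sup>-\<^sup>1 A\<^sub>i\<close> is self-adjoint
  for the nondegenerate, possibly indefinite, form \<open>u\<^sup>T B w\<close>. A maximal \<open>B\<close>-orthogonal family of
  non-isotropic common eigenvectors is a basis: projecting any common eigenvector off the family
  gives a common eigenvector that is isotropic by maximality and then lies in the radical of the form.
  In this basis \<open>B\<close> and all \<open>A\<^sub>i\<close> become diagonal by congruence.
\<close>

section \<open>Common eigenvectors of commuting diagonalizable maps\<close>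

text \<open>Applying \<open>f\<close> minus \<open>a\<close> times the identity to the vanishing sum
  kills the summand at \<open>a\<close> and scales each other one by
  \<open>c - a \<noteq> 0\<close>. Indexing the summands by their eigenvalues makes these
  distinct.\<close>

lemma sum_eigenvectors_eq_0:
  fixes f :: "'a::real_vector \<Rightarrow> 'a"
  assumes "linear f" "finite S" "\<And>c. c \<in> S \<Longrightarrow> f (w c) = c *\<^sub>R w c" "sum w S = 0"
  shows "\<forall>c\<in>S. w c = 0"
  using assms(2-)
proof (induction S arbitrary: w)
  case (insert a S)
  have "0 = f (sum w (insert a S)) - a *\<^sub>R sum w (insert a S)"
    unfolding insert.prems(2) by (simp add: linear_0 assms(1))
  also have "\<dots> = (\<Sum>c\<in>insert a S. f (w c) - a *\<^sub>R w c)"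
    by (simp only: linear_sum[OF assms(1)] scaleR_sum_right sum_subtractf)
  also have "\<dots> = (\<Sum>c\<in>insert a S. (c - a) *\<^sub>R w c)"
    using insert.prems(1) by (intro sum.cong) (simp_all add: scaleR_diff_left)
  also have "\<dots> = (\<Sum>c\<in>S. (c - a) *\<^sub>R w c)"
    using insert.hyps by simp
  finally have "\<forall>c\<in>S. (c - a) *\<^sub>R w c = 0"
    using insert.prems by (intro insert.IH) (simp_all add: linear_scale assms(1))
  then have "\<forall>c\<in>S. w c = 0"
    using insert.hyps by auto
  moreover from this have "w a = 0"
    using insert.hyps insert.prems by simp
  ultimately show ?case by simp
qed simp

text \<open>Collecting terms with equal eigenvalue leaves one summand per eigenvalue, the form to
  which \<open>sum_eigenvectors_eq_0\<close> applies.\<close>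

lemma span_eigenvectors_decomposition:
  fixes f :: "'a::real_vector \<Rightarrow> 'a"
  assumes "linear f" "x \<in> span {u. \<exists>c. f u = c *\<^sub>R u}"
  shows "\<exists>S w. finite S \<and> (\<forall>c\<in>S. f (w c) = c *\<^sub>R w c) \<and> x = sum w S"
  using assms(2)
proof (induction rule: span_induct_alt)
  case base
  show ?case by (intro exI[of _ "{}"]) simp
next
  case (step a u y)
  obtain d where d: "f u = d *\<^sub>R u"
    using step.hyps by auto
  obtain S w where S: "finite S" "\<forall>c\<in>S. f (w c) = c *\<^sub>R w c" "y = sum w S"
    using step.IH by auto
  \<comment> \<open>The new term joins the summand of its eigenvalue \<open>d\<close>; if
    \<open>d\<close> is new, \<open>w d\<close> is arbitrary and must be replaced by 0.\<close>
  let ?w = "w(d := (if d \<in> S then w d else 0) + a *\<^sub>R u)"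
  have "sum ?w (insert d S) = ?w d + sum ?w (S - {d})"
    using S by (simp add: sum.insert_remove)
  also have "sum ?w (S - {d}) = sum w (S - {d})"
    by (rule sum.cong) auto
  also have "?w d + sum w (S - {d}) = a *\<^sub>R u + y"
    using S by (auto simp: sum_diff1)
  finally have "a *\<^sub>R u + y = sum ?w (insert d S)" ..
  moreover have "\<forall>c\<in>insert d S. f (?w c) = c *\<^sub>R ?w c"
    using S(2) d
    by (auto simp: linear_add[OF assms(1)] linear_scale[OF assms(1)] linear_0[OF assms(1)] algebra_simps)
  ultimately show ?case
    using S(1) by blast
qed

text \<open>Induction on the operators: a common eigenvector of the earlier ones splits into
  eigenvectors of \<open>f a\<close>, and by commutation each component is still an eigenvector of
  the earlier ones.\<close>

lemma span_common_eigenvectors: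
  fixes f :: "'i \<Rightarrow> 'a::real_vector \<Rightarrow> 'a"
  assumes "finite I" "\<And>i. i \<in> I \<Longrightarrow> linear (f i)"
    and "\<And>i j x. i \<in> I \<Longrightarrow> j \<in> I \<Longrightarrow> f i (f j x) = f j (f i x)"
    and "\<And>i. i \<in> I \<Longrightarrow> span {u. \<exists>c. f i u = c *\<^sub>R u} = UNIV"
  shows "span {u. \<forall>i\<in>I. \<exists>c. f i u = c *\<^sub>R u} = UNIV"
  using assms
proof (induction I)
  case (insert a I)
  let ?E = "\<lambda>I. {u. \<forall>i\<in>I. \<exists>c. f i u = c *\<^sub>R u}"
  have lin: "linear (f i)" if "i \<in> insert a I" for i
    using insert.prems(1) that .
  have "u \<in> span (?E (insert a I))" if u: "u \<in> ?E I" for u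
  proof -
    have "u \<in> span {u. \<exists>c. f a u = c *\<^sub>R u}"
      using insert.prems(3)[of a] by auto
    with lin[of a] obtain S w
      where S: "finite S" "\<forall>c\<in>S. f a (w c) = c *\<^sub>R w c" "u = sum w S"
      using span_eigenvectors_decomposition[of "f a" u] by auto
    have "w c \<in> ?E (insert a I)" if c: "c \<in> S" for c
    proof -
      have "f i (w c) = d *\<^sub>R w c" if i: "i \<in> I" and d: "f i u = d *\<^sub>R u" for i d
      proof -
        \<comment> \<open>By commutation these differences satisfy the eigenvector equation of
          \<open>f a\<close> for \<open>c\<close>, and they add up to
          \<open>f i u - d *\<^sub>R u = 0\<close>.\<close>
        have "\<forall>c\<in>S. f i (w c) - d *\<^sub>R w c = 0"
        proof (rule sum_eigenvectors_eq_0[of "f a"])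
          show "linear (f a)" by (simp add: lin)
          show "(\<Sum>c\<in>S. f i (w c) - d *\<^sub>R w c) = 0"
            using d i lin[of i] by (simp add: S(3) linear_sum sum_subtractf scaleR_sum_right)
          fix c assume c: "c \<in> S"
          have "f a (f i (w c)) = f i (f a (w c))"
            using insert.prems(2) i by simp
          then show "f a (f i (w c) - d *\<^sub>R w c) = c *\<^sub>R (f i (w c) - d *\<^sub>R w c)"
            using S(2) c lin[of i] lin[of a] i by (simp add: linear_diff linear_scale algebra_simps)
        qed (use S in simp)
        then show ?thesis using c by simp
      qed
      then have "\<forall>i\<in>I. \<exists>d. f i (w c) = d *\<^sub>R w c"
        using u by blast
      then show ?thesis using S(2) c by blast
    qed
    then show ?thesis unfolding S(3) by (intro span_sum span_base)
  qed
  then have "span (?E I) \<subseteq> span (?E (insert a I))"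
    by (intro span_minimal subspace_span) auto
  then show ?case using insert by auto
qed simp

section \<open>Orthogonal eigenbases for a possibly indefinite form\<close>

lemma orthogonal_common_eigenbasis:
  fixes b :: "'a::euclidean_space \<Rightarrow> 'a \<Rightarrow> real" and f :: "'i \<Rightarrow> 'a \<Rightarrow> 'a"
  assumes b: "bilinear b" and sym: "\<And>u w. b u w = b w u"
    and nondeg: "\<And>u. (\<And>w. b u w = 0) \<Longrightarrow> u = 0"
    and lin: "\<And>i. i \<in> I \<Longrightarrow> linear (f i)"
    and selfadj: "\<And>i u w. i \<in> I \<Longrightarrow> b (f i u) w = b u (f i w)"
    and E: "E = {u. \<forall>i\<in>I. \<exists>c. f i u = c *\<^sub>R u}" and spanE: "span E = UNIV"
  shows "\<exists>F\<subseteq>E. independent F \<and> span F = UNIV \<and> pairwise (\<lambda>u v. b u v = 0) F"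
proof -
  have eig: "\<exists>c. f i u = c *\<^sub>R u" if "u \<in> E" "i \<in> I" for u i
    using that unfolding E by blast
  have linl: "linear (\<lambda>u. b u w)" and linr: "linear (b u)" for u w
    using b by (auto simp: bilinear_def)
  note bs = linear_add[OF linl] linear_add[OF linr] linear_diff[OF linl] linear_diff[OF linr]
    linear_scale[OF linl] linear_scale[OF linr] linear_sum[OF linl] linear_sum[OF linr]
    linear_0[OF linl] linear_0[OF linr]
  \<comment> \<open>Non-isotropy stands in for definiteness: it makes such families independent,
    hence bounded in size by the dimension, and allows division by \<open>b v v\<close> in the
    projection.\<close>
  define P where "P F \<longleftrightarrow> F \<subseteq> E \<and> (\<forall>v\<in>F. b v v \<noteq> 0) \<and> pairwise (\<lambda>u v. b u v = 0) F" for F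
  have coeff: "b (\<Sum>v\<in>T. q v *\<^sub>R v) v0 = q v0 * b v0 v0"
    if "P F" "finite T" "T \<subseteq> F" "v0 \<in> T" for F T q v0
  proof -
    have "b v v0 = 0" if "v \<in> T" "v \<noteq> v0" for v
      using that \<open>P F\<close> \<open>T \<subseteq> F\<close> \<open>v0 \<in> T\<close> unfolding P_def pairwise_def by blast
    then have "b (\<Sum>v\<in>T. q v *\<^sub>R v) v0 = (\<Sum>v\<in>T. if v = v0 then q v0 * b v0 v0 else 0)"
      unfolding bs by (intro sum.cong) auto
    then show ?thesis using that by simp
  qed
  have indep: "independent F" if "P F" for F
  proof
    assume "dependent F"
    then obtain T q v where T: "finite T" "T \<subseteq> F" "v \<in> T" "q v \<noteq> 0" "(\<Sum>v\<in>T. q v *\<^sub>R v) = 0"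
      unfolding dependent_explicit by blast
    then have "q v * b v v = 0"
      using coeff[OF that T(1-3), of q] by (simp add: linear_0[OF linl])
    moreover have "b v v \<noteq> 0"
      using that T(2,3) unfolding P_def by blast
    ultimately show False using T(4) by simp
  qed
  have fin: "finite F \<and> card F \<le> DIM('a)" if "P F" for F
    using indep[OF that] independent_bound by blast
  have "P {}" by (simp add: P_def)
  moreover have "\<forall>G. P G \<longrightarrow> card G < Suc DIM('a)"
    using fin by (simp add: less_Suc_eq_le)
  ultimately have "\<exists>F. P F \<and> (\<forall>G. P G \<longrightarrow> card G \<le> card F)"
    by (rule ex_has_greatest_nat)
  then obtain F where F: "P F" and Fmax: "\<And>G. P G \<Longrightarrow> card G \<le> card F"
    by blast
  have finF: "finite F" using fin[OF F] by simp
  define Z where "Z = {z \<in> E. \<forall>v\<in>F. b z v = 0}"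
  have isotropic: "b z z = 0" if z: "z \<in> Z" for z
  proof (rule ccontr)
    assume nz: "b z z \<noteq> 0"
    then have "z \<notin> F" using z by (auto simp: Z_def)
    moreover have "P (insert z F)"
      using F z nz sym by (auto simp: P_def Z_def pairwise_insert)
    ultimately show False
      using Fmax[of "insert z F"] finF by simp
  qed
  \<comment> \<open>Equal eigenvalues throughout: polarise, since the sum is again a common eigenvector.
    Different eigenvalues of some operator: orthogonality by self-adjointness.\<close>
  have Z0: "b y z = 0" if y: "y \<in> Z" and z: "z \<in> Z" for y z
  proof (cases "\<forall>i\<in>I. \<exists>c. f i y = c *\<^sub>R y \<and> f i z = c *\<^sub>R z")
    case True
    have "y + z \<in> E"
      unfolding E using True lin by (fastforce simp: linear_add scaleR_right_distrib)
    then have "y + z \<in> Z"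
      using y z by (simp add: Z_def bs)
    then show ?thesis
      using isotropic[of "y + z"] isotropic[OF y] isotropic[OF z] sym[of z y] by (simp add: bs)
  next
    case False
    then obtain i where i: "i \<in> I" "\<nexists>c. f i y = c *\<^sub>R y \<and> f i z = c *\<^sub>R z" by blast
    obtain c where c: "f i y = c *\<^sub>R y"
      using eig[of y i] y i(1) unfolding Z_def by blast
    obtain d where d: "f i z = d *\<^sub>R z"
      using eig[of z i] z i(1) unfolding Z_def by blast
    have "c \<noteq> d" using i(2) c d by blast
    then show ?thesis using selfadj[OF i(1), of y z] c d by (simp add: bs)
  qed
  \<comment> \<open>The \<open>b\<close>-orthogonal projection off the span of
    \<open>F\<close>.\<close>
  define p where "p u = u - (\<Sum>v\<in>F. (b u v / b v v) *\<^sub>R v)" for u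
  have p_orth: "b (p u) v = 0" if "v \<in> F" for u v
    using coeff[OF F finF subset_refl that, of "\<lambda>v. b u v / b v v"] that F
    by (simp add: p_def bs P_def)
  have pZ: "p u \<in> Z" if u: "u \<in> E" for u
  proof -
    have "\<exists>c. f i (p u) = c *\<^sub>R p u" if i: "i \<in> I" for i
    proof -
      obtain c where c: "f i u = c *\<^sub>R u" using eig[OF u i] by blast
      \<comment> \<open>Either \<open>b u v = 0\<close> and both sides vanish, or self-adjointness
        forces \<open>u\<close> and \<open>v\<close> to have the same eigenvalue.\<close>
      have "(b u v / b v v) *\<^sub>R f i v = c *\<^sub>R (b u v / b v v) *\<^sub>R v" if "v \<in> F" for v
      proof -
        have "v \<in> E" using that F unfolding P_def by blast
        then obtain d where d: "f i v = d *\<^sub>R v" using eig i by blast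
        have "c * b u v = d * b u v"
          using selfadj[OF i, of u v] c d by (simp add: bs)
        then show ?thesis using d by auto
      qed
      then have "(\<Sum>v\<in>F. (b u v / b v v) *\<^sub>R f i v) = (\<Sum>v\<in>F. c *\<^sub>R (b u v / b v v) *\<^sub>R v)"
        by (rule sum.cong[OF refl])
      then have "f i (p u) = c *\<^sub>R p u"
        unfolding p_def linear_diff[OF lin[OF i]] linear_sum[OF lin[OF i]] linear_scale[OF lin[OF i]]
          scaleR_diff_right scaleR_sum_right c by simp
      then show ?thesis ..
    qed
    then show ?thesis using p_orth by (simp add: Z_def E)
  qed
  have "u \<in> span F" if u: "u \<in> E" for u
  proof -
    have "b (p u) w = 0" if w: "w \<in> E" for w
    proof -
      \<comment> \<open>\<open>w\<close> and \<open>p w\<close> differ by a combination of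
        \<open>F\<close>, to which \<open>p u\<close> is orthogonal. As \<open>Z0\<close> kills the
        left side and \<open>E\<close> spans, \<open>p u\<close> lies in the radical.\<close>
      have "b (p u) (p w) = b (p u) w"
        by (simp add: p_def[of w] bs p_orth)
      then show ?thesis using Z0 pZ u w by auto
    qed
    moreover have "w \<in> span E" for w
      by (simp add: spanE)
    ultimately have "b (p u) w = 0" for w
      using linear_eq_0_on_span[OF linr, of E "p u" w] by blast
    then have "u = (\<Sum>v\<in>F. (b u v / b v v) *\<^sub>R v)"
      using nondeg[of "p u"] by (simp add: p_def)
    also have "\<dots> \<in> span F"
      by (intro span_sum span_scale span_base)
    finally show ?thesis .
  qed
  then have "span E \<subseteq> span F"
    by (intro span_minimal subspace_span) auto
  then show ?thesis
    using F indep[OF F] spanE by (auto simp: P_def)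
qed

section \<open>Inverses and diagonal matrices\<close>

lemma matrix_inv_left_right:
  assumes "invertible M"
  shows "matrix_inv M ** M = mat 1" "M ** matrix_inv M = mat 1"
  using someI_ex[OF assms[unfolded invertible_def]] by (simp_all add: matrix_inv_def)

lemma matrix_inv_eqI:
  fixes M N :: "'a::field^'n^'n"
  assumes "M ** N = mat 1"
  shows "matrix_inv M = N"
proof -
  have "invertible M" using assms invertible_right_inverse by blast
  then have "N = matrix_inv M ** M ** N" by (simp add: matrix_inv_left_right)
  also have "\<dots> = matrix_inv M" by (simp add: assms flip: matrix_mul_assoc)
  finally show ?thesis ..
qed

lemma matrix_mult_diagonal_nth:
  fixes D :: "'a::semiring_1^'n^'n"
  assumes "diagonal_matrix D"
  shows "(D ** X) $ i $ j = D $ i $ i * X $ i $ j" "(Y ** D) $ i $ j = Y $ i $ j * D $ j $ j"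
proof -
  have "(D ** X) $ i $ j = (\<Sum>k\<in>UNIV. if k = i then D $ i $ i * X $ i $ j else 0)"
    unfolding matrix_matrix_mult_def vec_lambda_beta
    by (intro sum.cong) (use assms in \<open>auto simp: diagonal_matrix_def\<close>)
  then show "(D ** X) $ i $ j = D $ i $ i * X $ i $ j" by simp
  have "(Y ** D) $ i $ j = (\<Sum>k\<in>UNIV. if k = j then Y $ i $ j * D $ j $ j else 0)"
    unfolding matrix_matrix_mult_def vec_lambda_beta
    by (intro sum.cong) (use assms in \<open>auto simp: diagonal_matrix_def\<close>)
  then show "(Y ** D) $ i $ j = Y $ i $ j * D $ j $ j" by simp
qed

lemma diagonal_matrix_vector_mult_nth:
  fixes D :: "'a::semiring_1^'n^'n"
  assumes "diagonal_matrix D"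
  shows "(D *v x) $ i = D $ i $ i * x $ i"
proof -
  have "(D *v x) $ i = (\<Sum>k\<in>UNIV. if k = i then D $ i $ i * x $ i else 0)"
    unfolding matrix_vector_mult_def vec_lambda_beta
    by (intro sum.cong) (use assms in \<open>auto simp: diagonal_matrix_def\<close>)
  then show ?thesis by simp
qed

lemma diagonal_matrix_mult:
  fixes D X :: "'a::semiring_1^'n^'n"
  assumes "diagonal_matrix D" "diagonal_matrix X"
  shows "diagonal_matrix (D ** X)"
  using assms by (simp add: diagonal_matrix_def matrix_mult_diagonal_nth(1))

lemma diagonal_matrix_commute:
  fixes D X :: "'a::comm_semiring_1^'n^'n"
  assumes "diagonal_matrix D" "diagonal_matrix X"
  shows "D ** X = X ** D"
  unfolding vec_eq_iff
proof (intro allI)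
  fix i j
  show "(D ** X) $ i $ j = (X ** D) $ i $ j"
    using assms(2) unfolding matrix_mult_diagonal_nth[OF assms(1)] diagonal_matrix_def
    by (cases "i = j") (auto simp: mult.commute)
qed

lemma diagonal_matrix_inv:
  fixes D :: "'a::field^'n^'n"
  assumes "diagonal_matrix D" "invertible D"
  shows "diagonal_matrix (matrix_inv D)"
  unfolding diagonal_matrix_def
proof (intro allI impI)
  fix i j :: 'n assume ij: "i \<noteq> j"
  \<comment> \<open>Taking \<open>l = i\<close> shows that the diagonal entry is nonzero; then
    \<open>l = j\<close> forces the off-diagonal entry of the inverse to vanish.\<close>
  have eq: "D $ i $ i * matrix_inv D $ i $ l = mat 1 $ i $ l" for l
    using matrix_mult_diagonal_nth(1)[OF assms(1), of "matrix_inv D" i l]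
    by (simp add: matrix_inv_left_right assms(2))
  show "matrix_inv D $ i $ j = 0"
    using eq[of i] eq[of j] ij by (auto simp: mat_def)
qed

section \<open>Real and complex diagonalization\<close>

lemma map_matrix_of_real_mult:
  "map_matrix complex_of_real (M ** N) = map_matrix complex_of_real M ** map_matrix complex_of_real N"
  by (simp add: vec_eq_iff matrix_matrix_mult_def)

lemma map_matrix_of_real_mat_1: "map_matrix complex_of_real (mat 1) = mat 1"
  by (simp add: vec_eq_iff mat_def)

text \<open>The entrywise embedding into the complex matrices respects products, so \<open>P\<close>
  and \<open>D\<close> still diagonalize, and every complex eigenvalue is one of the real diagonal
  entries.\<close>

lemma diagonalizable_real_eigenvaluesI:
  fixes P D :: "real^'n^'n"
  assumes P: "invertible P" and D: "diagonal_matrix D"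
  shows "diagonalizable_real_eigenvalues (P ** D ** matrix_inv P)"
proof -
  let ?c = "map_matrix complex_of_real :: real^'n^'n \<Rightarrow> complex^'n^'n"
  have PQ: "?c P ** ?c (matrix_inv P) = mat 1"
    by (simp add: matrix_inv_left_right P map_matrix_of_real_mat_1 flip: map_matrix_of_real_mult)
  have QP: "?c (matrix_inv P) ** ?c P = mat 1"
    by (simp add: matrix_inv_left_right P map_matrix_of_real_mat_1 flip: map_matrix_of_real_mult)
  have inv: "invertible (?c P)"
    using PQ QP unfolding invertible_def by blast
  have D': "diagonal_matrix (?c D)"
    using D by (simp add: diagonal_matrix_def)
  have M: "?c (P ** D ** matrix_inv P) = ?c P ** ?c D ** matrix_inv (?c P)"
    by (simp add: map_matrix_of_real_mult matrix_inv_eqI[OF PQ])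
  have "c \<in> \<real>" if ev: "eigenvalue (?c (P ** D ** matrix_inv P)) c" for c
  proof -
    obtain v where v: "v \<noteq> 0" "?c (P ** D ** matrix_inv P) *v v = c *s v"
      using ev unfolding eigenvalue_def by blast
    \<comment> \<open>The coordinates of \<open>v\<close> in the eigenbasis; a nonzero one
      identifies \<open>c\<close> with the matching diagonal entry.\<close>
    define u where "u = ?c (matrix_inv P) *v v"
    have vu: "v = ?c P *v u"
      by (simp add: u_def matrix_vector_mul_assoc PQ)
    then have "u \<noteq> 0" using v(1) by auto
    then obtain i where i: "u $ i \<noteq> 0" by (auto simp: vec_eq_iff)
    have "?c D *v u = (?c (matrix_inv P) ** ?c P) *v (?c D *v u)"
      by (simp add: QP)
    also have "\<dots> = ?c (matrix_inv P) *v (?c (P ** D ** matrix_inv P) *v v)"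
      by (simp add: u_def map_matrix_of_real_mult matrix_vector_mul_assoc matrix_mul_assoc)
    also have "\<dots> = c *s u"
      by (simp add: v(2) u_def vector_scalar_commute)
    finally have "?c D $ i $ i * u $ i = c * u $ i"
      using diagonal_matrix_vector_mult_nth[OF D', of u i] by auto
    then have "complex_of_real (D $ i $ i) = c" using i by simp
    then show "c \<in> \<real>" by auto
  qed
  then show ?thesis
    unfolding diagonalizable_real_eigenvalues_def diagonalizable_matrix_def using M inv D' by blast
qed

text \<open>Real parts of complex eigenvectors for real eigenvalues are eigenvectors, so no real
  diagonalizing matrix has to be constructed.\<close>
lemma diagonalizable_real_eigenvalues_span:
  fixes M :: "real^'n^'n"
  assumes "diagonalizable_real_eigenvalues M"
  shows "span {u. \<exists>c. M *v u = c *\<^sub>R u} = UNIV"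
proof -
  let ?M = "map_matrix complex_of_real M"
  obtain P D :: "complex^'n^'n" where P: "invertible P" and D: "diagonal_matrix D"
    and M: "?M = P ** D ** matrix_inv P"
    using assms unfolding diagonalizable_real_eigenvalues_def diagonalizable_matrix_def by blast
  have "?M ** P = P ** D"
    by (simp add: M matrix_inv_left_right P flip: matrix_mul_assoc)
  then have MP: "(\<Sum>k\<in>UNIV. complex_of_real (M $ i $ k) * P $ k $ j) = P $ i $ j * D $ j $ j" for i j
    using matrix_mult_diagonal_nth(2)[OF D, of P i j]
    by (metis (no_types, lifting) matrix_matrix_mult_def nth_map_matrix sum.cong vec_lambda_beta)
  \<comment> \<open>By \<open>MP\<close>, a nonzero column of \<open>P\<close> is an eigenvector for
    \<open>D $ j $ j\<close>, which is therefore real. The factor \<open>P $ i $ j\<close> lets the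
    same equation cover a zero column.\<close>
  have real: "\<exists>r. \<forall>i. P $ i $ j * D $ j $ j = P $ i $ j * complex_of_real r" for j
  proof (cases "column j P = 0")
    case True
    then show ?thesis by (auto simp: vec_eq_iff column_def)
  next
    case False
    have "?M *v column j P = D $ j $ j *s column j P"
      using MP by (simp add: vec_eq_iff matrix_vector_mult_def column_def mult.commute)
    then have "D $ j $ j \<in> \<real>"
      using assms False unfolding diagonalizable_real_eigenvalues_def eigenvalue_def by blast
    then show ?thesis by (auto simp: Reals_def)
  qed
  have "x \<in> span {u. \<exists>c. M *v u = c *\<^sub>R u}" for x
  proof -
    define y where "y = matrix_inv P *v (\<chi> i. complex_of_real (x $ i))"
    \<comment> \<open>The real part of the \<open>j\<close>th term of the expansion of
      \<open>x\<close> in the complex eigenbasis; as \<open>x\<close> is real, these parts add up to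
      \<open>x\<close>.\<close>
    define w where "w j = (\<chi> i. Re (P $ i $ j * y $ j))" for j
    have "P *v y = (\<chi> i. complex_of_real (x $ i))"
      by (simp add: y_def matrix_vector_mul_assoc matrix_inv_left_right P)
    then have "(\<Sum>j\<in>UNIV. P $ i $ j * y $ j) = complex_of_real (x $ i)" for i
      by (simp add: vec_eq_iff matrix_vector_mult_def)
    then have "x $ i = Re (\<Sum>j\<in>UNIV. P $ i $ j * y $ j)" for i
      by simp
    then have x: "x = (\<Sum>j\<in>UNIV. w j)"
      by (simp add: vec_eq_iff w_def)
    have "\<exists>c. M *v w j = c *\<^sub>R w j" for j
    proof -
      obtain r where r: "\<And>i. P $ i $ j * D $ j $ j = P $ i $ j * complex_of_real r"
        using real by blast
      have "(M *v w j) $ i = (r *\<^sub>R w j) $ i" for i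
      proof -
        have "(M *v w j) $ i = Re ((\<Sum>k\<in>UNIV. complex_of_real (M $ i $ k) * P $ k $ j) * y $ j)"
          by (simp add: matrix_vector_mult_def w_def sum_distrib_right mult.assoc
              del: times_complex.sel) (simp add: algebra_simps)
        also have "\<dots> = Re (complex_of_real r * (P $ i $ j * y $ j))"
          by (simp only: MP r) (simp only: ac_simps)
        also have "\<dots> = (r *\<^sub>R w j) $ i"
          by (simp add: w_def)
        finally show ?thesis .
      qed
      then show ?thesis by (auto simp: vec_eq_iff)
    qed
    then show ?thesis unfolding x by (intro span_sum span_base) auto
  qed
  then show ?thesis by blast
qed

section \<open>Commuting quotients and change of the base matrix\<close>

lemma linear_matrix_mult_left: "linear (\<lambda>X :: real^'n^'n. M ** X)"
  by (intro linearI) (simp_all add: vec_eq_iff matrix_matrix_mult_def sum.distrib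
      sum_distrib_left algebra_simps)

lemma linear_matrix_mult_right: "linear (\<lambda>X :: real^'n^'n. X ** M)"
  by (intro linearI) (simp_all add: vec_eq_iff matrix_matrix_mult_def sum.distrib
      sum_distrib_left algebra_simps)

text \<open>A linear image of a subspace is a subspace, so only commutation remains to be
  checked.\<close>

lemma commuting_subspace_quotient_iff:
  fixes M :: "real^'n^'n"
  assumes "subspace V"
  shows "commuting_subspace ((\<lambda>X. matrix_inv M ** X) ` V) \<longleftrightarrow>
    (\<forall>X\<in>V. \<forall>Y\<in>V. matrix_inv M ** X ** (matrix_inv M ** Y) = matrix_inv M ** Y ** (matrix_inv M ** X))"
proof -
  have "subspace ((\<lambda>X. matrix_inv M ** X) ` V)"
    by (rule linear_subspace_image[OF linear_matrix_mult_left assms])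
  then show ?thesis unfolding commuting_subspace_def ball_simps by blast
qed

text \<open>With \<open>?C\<close> the quotient by \<open>M\<close>, the quotient of
  \<open>X\<close> by \<open>N\<close> is \<open>?I ** ?C X\<close>. Here \<open>?I\<close> is the
  inverse of \<open>?C N\<close>, hence commutes with every \<open>?C X\<close> just as
  \<open>?C N\<close> does.\<close>

lemma commuting_subspace_change_base:
  fixes M N :: "real^'n^'n"
  assumes V: "subspace V" and M: "M \<in> V" "invertible M" and N: "N \<in> V" "invertible N"
    and comm: "commuting_subspace ((\<lambda>X. matrix_inv M ** X) ` V)"
  shows "commuting_subspace ((\<lambda>X. matrix_inv N ** X) ` V)"
proof -
  let ?C = "\<lambda>X. matrix_inv M ** X" and ?I = "matrix_inv N ** M"
  have C: "?C X ** ?C Y = ?C Y ** ?C X" if "X \<in> V" "Y \<in> V" for X Y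
    using comm that commuting_subspace_quotient_iff[OF V] by blast
  have NI: "?C N ** ?I = mat 1"
    by (metis M(2) N(2) matrix_inv_left_right matrix_mul_assoc matrix_mul_rid)
  have IN: "?I ** ?C N = mat 1"
    by (metis M(2) N(2) matrix_inv_left_right matrix_mul_assoc matrix_mul_rid)
  have quot: "matrix_inv N ** X = ?I ** ?C X" for X :: "real^'n^'n"
    by (metis M(2) matrix_inv_left_right(2) matrix_mul_assoc matrix_mul_rid)
  have IC: "?I ** ?C X = ?C X ** ?I" if X: "X \<in> V" for X
  proof -
    have "?I ** ?C X = ?I ** (?C X ** ?C N) ** ?I"
      by (metis NI matrix_mul_assoc matrix_mul_rid)
    also have "\<dots> = ?I ** (?C N ** ?C X) ** ?I"
      by (simp only: C[OF X N(1)])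
    also have "\<dots> = ?C X ** ?I"
      by (metis IN matrix_mul_assoc matrix_mul_lid)
    finally show ?thesis .
  qed
  have "matrix_inv N ** X ** (matrix_inv N ** Y) = matrix_inv N ** Y ** (matrix_inv N ** X)"
    if X: "X \<in> V" and Y: "Y \<in> V" for X Y
  proof -
    \<comment> \<open>With both copies of \<open>?I\<close> on the left, exchanging \<open>X\<close>
      and \<open>Y\<close> only exchanges commuting factors.\<close>
    have mult: "?I ** ?C X ** (?I ** ?C Y) = ?I ** ?I ** (?C X ** ?C Y)" if "X \<in> V" for X Y
    proof -
      have "?I ** ?C X ** (?I ** ?C Y) = ?I ** (?C X ** ?I) ** ?C Y"
        by (simp only: matrix_mul_assoc)
      also have "\<dots> = ?I ** (?I ** ?C X) ** ?C Y"
        by (simp only: IC[OF that])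
      finally show ?thesis
        by (simp only: matrix_mul_assoc)
    qed
    have "?I ** ?C X ** (?I ** ?C Y) = ?I ** ?C Y ** (?I ** ?C X)"
      unfolding mult[OF X] mult[OF Y] C[OF X Y] ..
    then show ?thesis unfolding quot[of X] quot[of Y] .
  qed
  then show ?thesis
    unfolding commuting_subspace_quotient_iff[OF V] by blast
qed

section \<open>Simultaneous diagonalization by congruence\<close>

text \<open>The factors \<open>R\<close> cancel in the quotient, turning a simultaneous congruence
  into a simultaneous similarity by \<open>T\<close>, with diagonal part
  \<open>matrix_inv D ** X\<close>.\<close>

lemma diagonal_congruence_quotient:
  fixes R T D X :: "real^'n^'n"
  assumes R: "invertible R" and T: "invertible T"
    and D: "diagonal_matrix D" "invertible (R ** D ** T)" and X: "diagonal_matrix X"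
  shows "\<exists>D'. diagonal_matrix D' \<and> matrix_inv (R ** D ** T) ** (R ** X ** T) = matrix_inv T ** D' ** T"
proof -
  have "det (R ** D ** T) \<noteq> 0" using D(2) by (simp add: invertible_det_nz)
  then have invD: "invertible D" by (simp add: det_mul invertible_det_nz)
  have "R ** D ** T ** (matrix_inv T ** matrix_inv D ** matrix_inv R) = mat 1"
    by (metis R T invD matrix_inv_left_right(2) matrix_mul_assoc matrix_mul_rid)
  then have "matrix_inv (R ** D ** T) ** (R ** X ** T) =
      matrix_inv T ** matrix_inv D ** matrix_inv R ** (R ** X ** T)"
    using matrix_inv_eqI by metis
  also have "\<dots> = matrix_inv T ** (matrix_inv D ** X) ** T"
    by (metis R matrix_inv_left_right(1) matrix_mul_assoc matrix_mul_rid)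
  finally show ?thesis
    using diagonal_matrix_mult diagonal_matrix_inv D(1) invD X by blast
qed

text \<open>A \<open>b\<close>-orthogonal basis of common eigenvectors, taken as the columns of
  \<open>P\<close>, makes every \<open>transpose P ** A i ** P\<close> diagonal; \<open>R\<close> is
  then the transposed inverse of \<open>P\<close>.\<close>

lemma congruence_diagonal_if_commuting:
  fixes A :: "'i \<Rightarrow> real^'n^'n" and B :: "real^'n^'n"
  assumes I: "finite I" and A: "\<And>i. i \<in> I \<Longrightarrow> symmetric_matrix (A i)"
    and B: "symmetric_matrix B" "invertible B"
    and comm: "\<And>i j. i \<in> I \<Longrightarrow> j \<in> I \<Longrightarrow>
      matrix_inv B ** A i ** (matrix_inv B ** A j) = matrix_inv B ** A j ** (matrix_inv B ** A i)"
    and diag: "\<And>i. i \<in> I \<Longrightarrow> diagonalizable_real_eigenvalues (matrix_inv B ** A i)"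
  shows "\<exists>(R :: real^'n^'n) \<Lambda>. invertible R \<and>
    (\<forall>i\<in>I. diagonal_matrix (\<Lambda> i) \<and> A i = R ** \<Lambda> i ** transpose R)"
proof -
  define f where "f i u = (matrix_inv B ** A i) *v u" for i u
  define b where "b u w = u \<bullet> (B *v w)" for u w
  have Bf: "B *v f i u = A i *v u" for i u
    by (simp add: f_def matrix_vector_mul_assoc matrix_mul_assoc matrix_inv_left_right B(2))
  have symm: "(S *v u) \<bullet> w = u \<bullet> (S *v w)" if "symmetric_matrix S" for S :: "real^'n^'n" and u w
    using that by (metis dot_lmul_matrix symmetric_matrix_def transpose_matrix_vector)
  define E where "E = {u. \<forall>i\<in>I. \<exists>c. f i u = c *\<^sub>R u}"
  have lin: "linear (f i)" for i
    unfolding f_def by simp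
  have spanE: "span E = UNIV"
    unfolding E_def
  proof (rule span_common_eigenvectors[OF I lin])
    show "f i (f j x) = f j (f i x)" if "i \<in> I" "j \<in> I" for i j x
      unfolding f_def matrix_vector_mul_assoc comm[OF that] ..
    show "span {u. \<exists>c. f i u = c *\<^sub>R u} = UNIV" if "i \<in> I" for i
      unfolding f_def using diagonalizable_real_eigenvalues_span[OF diag[OF that]] .
  qed
  have "\<exists>F\<subseteq>E. independent F \<and> span F = UNIV \<and> pairwise (\<lambda>u v. b u v = 0) F"
  proof (rule orthogonal_common_eigenbasis[OF _ _ _ lin _ E_def spanE])
    show "bilinear b"
      unfolding bilinear_def b_def
      by (auto intro!: linearI simp: inner_add matrix_vector_right_distrib
          matrix_vector_mult_scaleR)
    show "b u w = b w u" for u w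
      unfolding b_def using symm[OF B(1), of w u] by (simp add: inner_commute)
    show "u = 0" if "\<And>w. b u w = 0" for u
    proof -
      \<comment> \<open>This choice of second argument turns the form into the definite inner
        product.\<close>
      have "b u (matrix_inv B *v u) = u \<bullet> u"
        by (simp add: b_def matrix_vector_mul_assoc matrix_inv_left_right B(2))
      with that show ?thesis by simp
    qed
    \<comment> \<open>Both sides equal \<open>(A i *v u) \<bullet> w\<close>, by the symmetry of
      \<open>B\<close> and of \<open>A i\<close>.\<close>
    show "b (f i u) w = b u (f i w)" if i: "i \<in> I" for i u w
    proof -
      have "b (f i u) w = (B *v f i u) \<bullet> w"
        by (simp add: b_def symm B(1))
      also have "\<dots> = b u (f i w)"
        by (simp add: Bf b_def symm A i)
      finally show ?thesis .
    qed
  qed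
  then obtain F where F: "F \<subseteq> E" "independent F" "span F = UNIV"
    and orth: "pairwise (\<lambda>u v. b u v = 0) F"
    by blast
  have "card F = CARD('n)" "finite F"
    using F(2,3) dim_span_eq_card_independent[OF F(2)] independent_bound by auto
  then obtain g where g: "bij_betw g (UNIV :: 'n set) F"
    using finite_same_card_bij[of "UNIV :: 'n set" F] by auto
  define P where "P = (\<chi> i j. g j $ i)"
  have "column j P = g j" for j
    by (simp add: P_def column_def vec_eq_iff)
  then have "columns P = F"
    using g by (auto simp: columns_def bij_betw_def)
  then have "\<exists>Q. P ** Q = mat 1"
    using F(3) matrix_right_invertible_span_columns[of P] by (simp add: span_vec_eq)
  then obtain Q where PQ: "P ** Q = mat 1" ..
  have QtPt: "transpose Q ** transpose P = mat 1"
    by (metis PQ matrix_transpose_mul transpose_mat)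
  have "diagonal_matrix (transpose P ** A i ** P)" if i: "i \<in> I" for i
    unfolding diagonal_matrix_def
  proof (intro allI impI)
    fix j l :: 'n assume "j \<noteq> l"
    then have "b (g j) (g l) = 0"
      using orth g unfolding pairwise_def bij_betw_def inj_on_def by blast
    moreover obtain c where "f i (g l) = c *\<^sub>R g l"
      using F(1) g i unfolding E_def bij_betw_def by blast
    \<comment> \<open>Multiplying the eigenvector equation by \<open>B\<close> carries
      \<open>B\<close>-orthogonality over to \<open>A i\<close>.\<close>
    then have "A i *v g l = c *\<^sub>R (B *v g l)"
      by (metis Bf matrix_vector_mult_scaleR)
    ultimately have "g j \<bullet> (A i *v g l) = 0"
      by (simp add: b_def)
    moreover have "(transpose P ** A i ** P) $ j $ l = g j \<bullet> (A i *v g l)"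
      unfolding matrix_mul_assoc[symmetric]
      by (simp add: matrix_matrix_mult_def matrix_vector_mult_def inner_vec_def P_def transpose_def)
    ultimately show "(transpose P ** A i ** P) $ j $ l = 0" by simp
  qed
  moreover have "A i = transpose Q ** (transpose P ** A i ** P) ** transpose (transpose Q)" for i
    by (metis PQ QtPt matrix_mul_assoc matrix_mul_lid matrix_mul_rid transpose_transpose)
  moreover have "invertible (transpose Q)"
    using QtPt invertible_right_inverse by blast
  ultimately show ?thesis
    by (intro exI[of _ "transpose Q"] exI[of _ "\<lambda>i. transpose P ** A i ** P"]) blast
qed

section \<open>From the generators to their span, and the equivalence\<close>

lemma subspace_symmetric_matrix: "subspace {M :: real^'n^'n. symmetric_matrix M}"
  unfolding subspace_def symmetric_matrix_def by (simp add: vec_eq_iff transpose_def)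

text \<open>Serves to extend the decomposition from the matrices \<open>A i\<close> to all of
  \<open>V\<close> by minimality of the span.\<close>

lemma subspace_diagonal_congruence:
  fixes R T :: "real^'n^'n"
  shows "subspace {R ** D ** T | D. diagonal_matrix D}"
proof -
  have "linear (\<lambda>D. R ** D ** T)"
    using linear_compose[OF linear_matrix_mult_left linear_matrix_mult_right] by (simp add: o_def)
  moreover have "subspace {D :: real^'n^'n. diagonal_matrix D}"
    unfolding subspace_def diagonal_matrix_def by simp
  moreover have "{R ** D ** T | D. diagonal_matrix D} = (\<lambda>D. R ** D ** T) ` {D. diagonal_matrix D}"
    by auto
  ultimately show ?thesis using linear_subspace_image by metis
qed

theorem theorem2p11:
  fixes A :: "nat \<Rightarrow> real^'n^'n" and k :: nat and V :: "(real^'n^'n) set"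
  assumes symmetric: "\<And>i. i \<in> {1..k} \<Longrightarrow> symmetric_matrix (A i)"
    and V: "V = span (A ` {1..k})"
    and nonsingular: "\<exists>M\<in>V. invertible M"
  shows "((\<exists>(R :: real^'n^'n) (\<Lambda> :: nat \<Rightarrow> real^'n^'n). invertible R \<and>
             (\<forall>i\<in>{1..k}. diagonal_matrix (\<Lambda> i) \<and> A i = R ** \<Lambda> i ** transpose R)) \<longleftrightarrow>
          (\<exists>M\<in>V. invertible M \<and> commuting_subspace ((\<lambda>X. matrix_inv M ** X) ` V)) \<and>
          (\<exists>B\<in>V. invertible B \<and>
             (\<forall>i\<in>{1..k}. diagonalizable_real_eigenvalues (matrix_inv B ** A i))))
       \<and> ((\<exists>M\<in>V. invertible M \<and> commuting_subspace ((\<lambda>X. matrix_inv M ** X) ` V)) \<longleftrightarrow>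
          (\<forall>M\<in>V. invertible M \<longrightarrow> commuting_subspace ((\<lambda>X. matrix_inv M ** X) ` V)))"
proof -
  have subV: "subspace V" unfolding V by (rule subspace_span)
  have AV: "A i \<in> V" if "i \<in> {1..k}" for i
    unfolding V using that by (intro span_base) simp
  have "V \<subseteq> {M. symmetric_matrix M}"
    unfolding V by (rule span_minimal) (use symmetric subspace_symmetric_matrix in auto)
  then have symV: "symmetric_matrix M" if "M \<in> V" for M
    using that by blast
  have equiv: "(\<exists>M\<in>V. invertible M \<and> commuting_subspace ((\<lambda>X. matrix_inv M ** X) ` V)) \<longleftrightarrow>
      (\<forall>M\<in>V. invertible M \<longrightarrow> commuting_subspace ((\<lambda>X. matrix_inv M ** X) ` V))"
    using nonsingular commuting_subspace_change_base[OF subV] by blast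
  \<comment> \<open>Proved for an arbitrary nonsingular \<open>M\<close> in \<open>V\<close>, so one
    matrix can witness both (a) and (b).\<close>
  have forward: "commuting_subspace ((\<lambda>X. matrix_inv M ** X) ` V) \<and>
      (\<forall>i\<in>{1..k}. diagonalizable_real_eigenvalues (matrix_inv M ** A i))"
    if R: "invertible R" and
      L: "\<forall>i\<in>{1..k}. diagonal_matrix (\<Lambda> i) \<and> A i = R ** \<Lambda> i ** transpose R"
      and M: "M \<in> V" "invertible M" for R M :: "real^'n^'n" and \<Lambda> :: "nat \<Rightarrow> real^'n^'n"
  proof -
    let ?T = "transpose R"
    have T: "invertible ?T" using R by (simp add: invertible_det_nz)
    have "V \<subseteq> {R ** D ** ?T | D. diagonal_matrix D}"
      unfolding V by (rule span_minimal[OF _ subspace_diagonal_congruence]) (use L in blast)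
    then have RDT: "\<exists>D. diagonal_matrix D \<and> X = R ** D ** ?T" if "X \<in> V" for X
      using that by blast
    obtain D where D: "diagonal_matrix D" "M = R ** D ** ?T"
      using RDT[OF M(1)] by blast
    have quot: "\<exists>D'. diagonal_matrix D' \<and> matrix_inv M ** X = matrix_inv ?T ** D' ** ?T" if "X \<in> V" for X
      using RDT[OF that] diagonal_congruence_quotient[OF R T D(1)] M(2) D(2) by blast
    have "matrix_inv M ** X ** (matrix_inv M ** Y) = matrix_inv M ** Y ** (matrix_inv M ** X)"
      if X: "X \<in> V" and Y: "Y \<in> V" for X Y
    proof -
      obtain D1 where D1: "diagonal_matrix D1" "matrix_inv M ** X = matrix_inv ?T ** D1 ** ?T"
        using quot[OF X] by blast
      obtain D2 where D2: "diagonal_matrix D2" "matrix_inv M ** Y = matrix_inv ?T ** D2 ** ?T"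
        using quot[OF Y] by blast
      have mult: "matrix_inv ?T ** G ** ?T ** (matrix_inv ?T ** H ** ?T) = matrix_inv ?T ** (G ** H) ** ?T"
        for G H
        by (metis T matrix_inv_left_right(2) matrix_mul_assoc matrix_mul_rid)
      show ?thesis
        unfolding D1(2) D2(2) mult diagonal_matrix_commute[OF D1(1) D2(1)] ..
    qed
    then have "commuting_subspace ((\<lambda>X. matrix_inv M ** X) ` V)"
      unfolding commuting_subspace_quotient_iff[OF subV] by blast
    moreover have "diagonalizable_real_eigenvalues (matrix_inv M ** A i)" if i: "i \<in> {1..k}" for i
    proof -
      obtain D' where D': "diagonal_matrix D'" "matrix_inv M ** A i = matrix_inv ?T ** D' ** ?T"
        using quot[OF AV[OF i]] by blast
      \<comment> \<open>The diagonalizing matrix is \<open>matrix_inv ?T\<close>, so its own inverse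
        has to be recognized as \<open>?T\<close>.\<close>
      have TT: "matrix_inv ?T ** ?T = mat 1"
        by (simp add: matrix_inv_left_right T)
      then have "invertible (matrix_inv ?T)"
        using invertible_right_inverse by blast
      from diagonalizable_real_eigenvaluesI[OF this D'(1)] show ?thesis
        unfolding D'(2) matrix_inv_eqI[OF TT] .
    qed
    ultimately show ?thesis by blast
  qed
  \<comment> \<open>The witnesses of (a) and (b) may differ; the universal form of (a), supplied by
    \<open>equiv\<close>, gives commutation at the \<open>B\<close> of (b).\<close>
  have backward: "\<exists>(R :: real^'n^'n) (\<Lambda> :: nat \<Rightarrow> real^'n^'n). invertible R \<and>
      (\<forall>i\<in>{1..k}. diagonal_matrix (\<Lambda> i) \<and> A i = R ** \<Lambda> i ** transpose R)"
    if comm: "\<forall>M\<in>V. invertible M \<longrightarrow> commuting_subspace ((\<lambda>X. matrix_inv M ** X) ` V)"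
      and B: "B \<in> V" "invertible B"
      and diag: "\<forall>i\<in>{1..k}. diagonalizable_real_eigenvalues (matrix_inv B ** A i)" for B
  proof (rule congruence_diagonal_if_commuting[OF finite_atLeastAtMost symmetric symV[OF B(1)] B(2)])
    have "commuting_subspace ((\<lambda>X. matrix_inv B ** X) ` V)" using comm B by blast
    then show "matrix_inv B ** A i ** (matrix_inv B ** A j) = matrix_inv B ** A j ** (matrix_inv B ** A i)"
      if "i \<in> {1..k}" "j \<in> {1..k}" for i j
      using commuting_subspace_quotient_iff[OF subV] AV that by blast
  qed (use diag in auto)
  show ?thesis
  proof (rule conjI[OF _ equiv], rule iffI, goal_cases)
    case 1
    then obtain R :: "real^'n^'n" and \<Lambda> where "invertible R"
      "\<forall>i\<in>{1..k}. diagonal_matrix (\<Lambda> i) \<and> A i = R ** \<Lambda> i ** transpose R"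
      by blast
    from forward[OF this] show ?case using nonsingular by blast
  next
    case 2
    then show ?case using backward unfolding equiv by blast
  qed
qed

end
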